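(* In the test-preemptive setting, consider the Two Phases algorithm, which has access to an exact (optimal) offline algorithm OFF for classical makespan minimization on $m$ identical machines. In the first phase, every job with $t_j\le u_j$ is scheduled to be tested (a piece of length $t_j$) and every job with $t_j>u_j$ is scheduled to be run untested (a piece of length $u_j$); i.e. every job $j$ receives a piece of length $\tau_j=\min(t_j,u_j)$, and these pieces are assigned to machines by OFF. In the second phase, all processing times $p_j$ of the tested jobs are known, and the execution pieces (of lengths $p_j$) of all tested jobs are assigned to machines by OFF; this second schedule is placed after the first, starting once the first phase is completed. Then the Two Phases algorithm is $2$-competitive for makespan minimization on $m$ identical machines with testing in the test-preemptive setting.
   Context: Scheduling with testing on $m$ identical parallel machines: there are $n$ jobs; each job $j$ has a testing time $t_j\ge 0$, an upper bound $u_j\ge 0$ and a processing time $p_j$ with $0\le p_j\le u_j$. A job can either be run untested, requiring time $u_j$, or be tested (time $t_j$) and then executed (time $p_j$); the value $p_j$ is revealed to the algorithm only when the test of $j$ is completed, and any part of the execution must take place after the test is completed. Initially the algorithm knows $m$, $n$ and all $t_j,u_j$, but not the $p_j$. Test-preemptive setting: an untested job must be run without interruption on a single machine; for a tested job, its test must be run without interruption on one machine and its execution must be run without interruption on one (possibly different) machine, starting no earlier than the completion of the test. The objective is the makespan. $\mathrm{OPT}$ denotes the optimal makespan of an offline scheduler knowing all $p_j$. An algorithm is $c$-competitive if its makespan $\mathrm{ALG}$ satisfies $\mathrm{ALG}\le c\cdot\mathrm{OPT}$ on every instance. The algorithm is assumed to have unlimited computational power. *)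

theory Defs
  imports Complex_Main "HOL-Library.FuncSet"
begin

text \<open>
  A placement gives each piece of work a machine and a start time. Pieces run without
  interruption, so two pieces on a machine are ordered in time. This also keeps a piece of length
  zero from being placed strictly inside another piece.
\<close>

type_synonym 'a placement = "'a \<Rightarrow> nat \<times> real"

definition valid_placement :: "nat \<Rightarrow> 'a set \<Rightarrow> ('a \<Rightarrow> real) \<Rightarrow> 'a placement \<Rightarrow> bool" where
  "valid_placement m Q len \<sigma> \<longleftrightarrow>
     (\<forall>q\<in>Q. fst (\<sigma> q) < m \<and> 0 \<le> snd (\<sigma> q)) \<and>
     (\<forall>q\<in>Q. \<forall>r\<in>Q. q \<noteq> r \<and> fst (\<sigma> q) = fst (\<sigma> r) \<longrightarrow>
        snd (\<sigma> q) + len q \<le> snd (\<sigma> r) \<or> snd (\<sigma> r) + len r \<le> snd (\<sigma> q))"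

text \<open>The inserted 0 only matters for an empty set of pieces.\<close>

definition completion :: "'a set \<Rightarrow> ('a \<Rightarrow> real) \<Rightarrow> 'a placement \<Rightarrow> real" where
  "completion Q len \<sigma> = Max (insert 0 ((\<lambda>q. snd (\<sigma> q) + len q) ` Q))"

definition exact_offline :: "nat \<Rightarrow> (nat set \<Rightarrow> (nat \<Rightarrow> real) \<Rightarrow> nat placement) \<Rightarrow> bool" where
  "exact_offline m off \<longleftrightarrow>
     (\<forall>J len. finite J \<and> (\<forall>j\<in>J. 0 \<le> len j) \<longrightarrow>
        is_arg_min (completion J len) (valid_placement m J len) (off J len))"

text \<open>The jobs of an instance are \<open>0, \<dots>, njobs I - 1\<close>.\<close>

record inst =
  njobs :: nat
  test_time :: "nat \<Rightarrow> real"
  upper :: "nat \<Rightarrow> real"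
  proc :: "nat \<Rightarrow> real"

definition valid_inst :: "inst \<Rightarrow> bool" where
  "valid_inst I \<longleftrightarrow>
     (\<forall>j<njobs I. 0 \<le> test_time I j \<and> 0 \<le> upper I j \<and> 0 \<le> proc I j \<and> proc I j \<le> upper I j)"

datatype piece = Run nat | Test nat | Exec nat

fun piece_len :: "inst \<Rightarrow> piece \<Rightarrow> real" where
  "piece_len I (Run j) = upper I j"
| "piece_len I (Test j) = test_time I j"
| "piece_len I (Exec j) = proc I j"

record schedule =
  tested :: "nat set"
  place :: "piece placement"

definition pieces :: "inst \<Rightarrow> schedule \<Rightarrow> piece set" where
  "pieces I S = Run ` ({..<njobs I} - tested S) \<union> Test ` tested S \<union> Exec ` tested S"

abbreviation start :: "schedule \<Rightarrow> piece \<Rightarrow> real" where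
  "start S q \<equiv> snd (place S q)"

definition test_completion :: "inst \<Rightarrow> schedule \<Rightarrow> nat \<Rightarrow> real" where
  "test_completion I S j = start S (Test j) + test_time I j"

definition feasible :: "nat \<Rightarrow> inst \<Rightarrow> schedule \<Rightarrow> bool" where
  "feasible m I S \<longleftrightarrow>
     tested S \<subseteq> {..<njobs I} \<and>
     valid_placement m (pieces I S) (piece_len I) (place S) \<and>
     (\<forall>j\<in>tested S. test_completion I S j \<le> start S (Exec j))"

definition makespan :: "inst \<Rightarrow> schedule \<Rightarrow> real" where
  "makespan I S = completion (pieces I S) (piece_len I) (place S)"

definition opt :: "nat \<Rightarrow> inst \<Rightarrow> real" where
  "opt m I = Inf {makespan I S | S. feasible m I S}"

definition same_known_data :: "inst \<Rightarrow> inst \<Rightarrow> bool" where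
  "same_known_data I I' \<longleftrightarrow>
     njobs I = njobs I' \<and>
     (\<forall>j<njobs I. test_time I j = test_time I' j \<and> upper I j = upper I' j)"

definition started :: "inst \<Rightarrow> schedule \<Rightarrow> real \<Rightarrow> (piece \<times> nat \<times> real) set" where
  "started I S x = {(q, place S q) | q. q \<in> pieces I S \<and> start S q \<le> x}"

text \<open>
  An algorithm maps instances to schedules. It learns processing times only from completed tests:
  two instances that agree on the data known initially, and on every processing time revealed
  up to time \<open>x\<close>, are treated identically up to time \<open>x\<close>.
\<close>

definition nonanticipative :: "(inst \<Rightarrow> schedule) \<Rightarrow> bool" where
  "nonanticipative A \<longleftrightarrow>
     (\<forall>I I' x. valid_inst I \<and> valid_inst I' \<and> same_known_data I I' \<and>
        (\<forall>j\<in>tested (A I). test_completion I (A I) j \<le> x \<longrightarrow> proc I j = proc I' j) \<longrightarrow>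
        started I (A I) x = started I' (A I') x)"

definition online_algorithm :: "nat \<Rightarrow> (inst \<Rightarrow> schedule) \<Rightarrow> bool" where
  "online_algorithm m A \<longleftrightarrow> (\<forall>I. valid_inst I \<longrightarrow> feasible m I (A I)) \<and> nonanticipative A"

definition competitive :: "nat \<Rightarrow> real \<Rightarrow> (inst \<Rightarrow> schedule) \<Rightarrow> bool" where
  "competitive m c A \<longleftrightarrow> (\<forall>I. valid_inst I \<longrightarrow> makespan I (A I) \<le> c * opt m I)"

text \<open>
  The length functions given to \<open>off\<close> are restricted to the job set at hand, so that \<open>off\<close>
  cannot depend on processing times of jobs that are never tested.
\<close>

definition two_phases :: "(nat set \<Rightarrow> (nat \<Rightarrow> real) \<Rightarrow> nat placement) \<Rightarrow> inst \<Rightarrow> schedule" where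
  "two_phases off I =
     (let J = {..<njobs I};
          \<tau> = (\<lambda>j\<in>J. min (test_time I j) (upper I j));
          T = {j\<in>J. test_time I j \<le> upper I j};
          \<sigma>\<^sub>1 = off J \<tau>;
          C\<^sub>1 = completion J \<tau> \<sigma>\<^sub>1;
          \<sigma>\<^sub>2 = off T (\<lambda>j\<in>T. proc I j)
      in \<lparr>tested = T,
          place = (\<lambda>q. case q of
              Run j \<Rightarrow> \<sigma>\<^sub>1 j
            | Test j \<Rightarrow> \<sigma>\<^sub>1 j
            | Exec j \<Rightarrow> (fst (\<sigma>\<^sub>2 j), C\<^sub>1 + snd (\<sigma>\<^sub>2 j)))\<rparr>)"

end

theory Submission
  imports Defs
begin

text \<open>
  In any feasible schedule, every job \<open>j\<close> contributes a piece of length at least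
  \<open>\<tau>\<^sub>j = min t\<^sub>j u\<^sub>j\<close> (its test or its untested run), and also a piece of length at least \<open>p\<^sub>j\<close>
  (its execution, or its untested run because \<open>p\<^sub>j \<le> u\<^sub>j\<close>). Hence the schedule contains a
  placement of the first-phase pieces as well as one of the second-phase pieces, so each phase
  lasts at most \<open>OPT\<close>. The algorithm is nonanticipative because every execution starts at or after
  the end of the first phase, when all tests are complete.
\<close>

section \<open>Completion times and reindexed placements\<close>

lemma completion_ge:
  assumes "finite Q" "q \<in> Q"
  shows "snd (\<sigma> q) + len q \<le> completion Q len \<sigma>"
  unfolding completion_def using assms by (intro Max_ge) auto

lemma completion_nonneg:
  assumes "finite Q"
  shows "0 \<le> completion Q len \<sigma>"
  unfolding completion_def using assms by (intro Max_ge) auto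

lemma completion_leI:
  assumes "finite Q" "0 \<le> c" "\<And>q. q \<in> Q \<Longrightarrow> snd (\<sigma> q) + len q \<le> c"
  shows "completion Q len \<sigma> \<le> c"
  unfolding completion_def using assms by (subst Max_le_iff) auto

text \<open>Shortening pieces while keeping their machines and starts preserves each alternative of
  the disjointness condition. Injectivity turns distinct indices into distinct pieces, so that
  condition is available for their images.\<close>

lemma valid_placement_comp:
  assumes "valid_placement m Q len \<sigma>" "inj_on f J" "f ` J \<subseteq> Q"
    and "\<And>j. j \<in> J \<Longrightarrow> len' j \<le> len (f j)"
  shows "valid_placement m J len' (\<sigma> \<circ> f)"
  unfolding valid_placement_def
proof (intro conjI ballI impI)
  fix q assume "q \<in> J"
  then show "fst ((\<sigma> \<circ> f) q) < m" "0 \<le> snd ((\<sigma> \<circ> f) q)"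
    using assms(1,3) by (auto simp: valid_placement_def)
next
  fix q r assume q: "q \<in> J" and r: "r \<in> J"
    and ne: "q \<noteq> r \<and> fst ((\<sigma> \<circ> f) q) = fst ((\<sigma> \<circ> f) r)"
  have "f q \<noteq> f r" "f q \<in> Q" "f r \<in> Q"
    using q r ne assms(2,3) by (auto dest: inj_onD)
  then have "snd (\<sigma> (f q)) + len (f q) \<le> snd (\<sigma> (f r))
      \<or> snd (\<sigma> (f r)) + len (f r) \<le> snd (\<sigma> (f q))"
    using assms(1) ne by (auto simp: valid_placement_def)
  then show "snd ((\<sigma> \<circ> f) q) + len' q \<le> snd ((\<sigma> \<circ> f) r)
      \<or> snd ((\<sigma> \<circ> f) r) + len' r \<le> snd ((\<sigma> \<circ> f) q)"
    using assms(4)[OF q] assms(4)[OF r] by auto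
qed

lemma completion_comp_le:
  assumes "finite Q" "finite J" "f ` J \<subseteq> Q" "\<And>j. j \<in> J \<Longrightarrow> len' j \<le> len (f j)"
  shows "completion J len' (\<sigma> \<circ> f) \<le> completion Q len \<sigma>"
proof (rule completion_leI[OF assms(2) completion_nonneg[OF assms(1)]])
  fix j assume j: "j \<in> J"
  then have "snd (\<sigma> (f j)) + len (f j) \<le> completion Q len \<sigma>"
    using assms(1,3) by (intro completion_ge) auto
  then show "snd ((\<sigma> \<circ> f) j) + len' j \<le> completion Q len \<sigma>"
    using assms(4)[OF j] by simp
qed

section \<open>Consequences of offline optimality\<close>

lemma exact_offline_valid:
  assumes "exact_offline m off" "finite J" "\<And>j. j \<in> J \<Longrightarrow> 0 \<le> len j"
  shows "valid_placement m J len (off J len)"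
  using assms by (auto simp: exact_offline_def is_arg_min_def)

lemma exact_offline_le:
  assumes "exact_offline m off" "finite J" "\<And>j. j \<in> J \<Longrightarrow> 0 \<le> len j"
    and "valid_placement m J len \<sigma>"
  shows "completion J len (off J len) \<le> completion J len \<sigma>"
proof -
  have "is_arg_min (completion J len) (valid_placement m J len) (off J len)"
    using assms(1-3) by (simp add: exact_offline_def)
  then show ?thesis
    using assms(4) by (auto simp: is_arg_min_def not_less)
qed

text \<open>The reindexed placement \<open>\<sigma> \<circ> f\<close> is one of the candidates over
  which \<open>off\<close> minimises. Both phases are compared with an arbitrary schedule this way,
  with \<open>f\<close> selecting one sufficiently long piece per job.\<close>

lemma exact_offline_completion_le:
  assumes "exact_offline m off" "finite J" "\<And>j. j \<in> J \<Longrightarrow> 0 \<le> len' j"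
    and "valid_placement m Q len \<sigma>" "finite Q" "inj_on f J" "f ` J \<subseteq> Q"
    and "\<And>j. j \<in> J \<Longrightarrow> len' j \<le> len (f j)"
  shows "completion J len' (off J len') \<le> completion Q len \<sigma>"
proof -
  have "valid_placement m J len' (\<sigma> \<circ> f)"
    using assms by (intro valid_placement_comp[of m Q len])
  then have "completion J len' (off J len') \<le> completion J len' (\<sigma> \<circ> f)"
    using assms(1-3) by (intro exact_offline_le)
  also have "\<dots> \<le> completion Q len \<sigma>"
    using assms by (intro completion_comp_le)
  finally show ?thesis .
qed

section \<open>Lengths and placements of the two phases\<close>

lemma finite_pieces: "tested S \<subseteq> {..<njobs I} \<Longrightarrow> finite (pieces I S)"
  unfolding pieces_def by (auto intro: finite_subset)

text \<open>The restriction repeats the argument passed to \<open>off\<close> in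
  \<open>two_phases\<close>. Outside the jobs the value is \<open>undefined\<close> for every
  instance, so agreement on the jobs gives equal functions and hence equal calls to
  \<open>off\<close>. The same holds for \<open>exec_len\<close>.\<close>

definition first_len :: "inst \<Rightarrow> nat \<Rightarrow> real" where
  "first_len I = (\<lambda>j\<in>{..<njobs I}. min (test_time I j) (upper I j))"

definition tested_jobs :: "inst \<Rightarrow> nat set" where
  "tested_jobs I = {j \<in> {..<njobs I}. test_time I j \<le> upper I j}"

definition exec_len :: "inst \<Rightarrow> nat \<Rightarrow> real" where
  "exec_len I = (\<lambda>j\<in>tested_jobs I. proc I j)"

locale exact_two_phases =
  fixes m :: nat and off :: "nat set \<Rightarrow> (nat \<Rightarrow> real) \<Rightarrow> nat placement"
  assumes exact: "exact_offline m off"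
begin

definition first :: "inst \<Rightarrow> nat placement" where
  "first I = off {..<njobs I} (first_len I)"

definition first_end :: "inst \<Rightarrow> real" where
  "first_end I = completion {..<njobs I} (first_len I) (first I)"

definition second :: "inst \<Rightarrow> nat placement" where
  "second I = off (tested_jobs I) (exec_len I)"

definition second_end :: "inst \<Rightarrow> real" where
  "second_end I = completion (tested_jobs I) (exec_len I) (second I)"

lemma tested_two_phases [simp]: "tested (two_phases off I) = tested_jobs I"
  by (simp add: two_phases_def Let_def tested_jobs_def)

text \<open>Together with \<open>tested_two_phases\<close>, these equations are the interface to the
  algorithm: the later proofs never unfold \<open>two_phases\<close>.\<close>

lemma place_two_phases [simp]:
  "place (two_phases off I) (Run j) = first I j"
  "place (two_phases off I) (Test j) = first I j"
  "place (two_phases off I) (Exec j) = (fst (second I j), first_end I + snd (second I j))"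
  by (simp_all add: two_phases_def Let_def first_def second_def first_end_def
      first_len_def exec_len_def tested_jobs_def)

lemma pieces_two_phases:
  "pieces I (two_phases off I) =
     Run ` ({..<njobs I} - tested_jobs I) \<union> Test ` tested_jobs I \<union> Exec ` tested_jobs I"
  by (simp add: pieces_def)

lemma tested_jobs_less: "j \<in> tested_jobs I \<Longrightarrow> j < njobs I"
  by (simp add: tested_jobs_def)

lemma finite_tested_jobs: "finite (tested_jobs I)"
  by (simp add: tested_jobs_def)

lemma first_len_tested: "j \<in> tested_jobs I \<Longrightarrow> first_len I j = test_time I j"
  by (simp add: first_len_def tested_jobs_def)

lemma first_len_untested:
  "j < njobs I \<Longrightarrow> j \<notin> tested_jobs I \<Longrightarrow> first_len I j = upper I j"
  by (simp add: first_len_def tested_jobs_def)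

lemma exec_len_tested: "j \<in> tested_jobs I \<Longrightarrow> exec_len I j = proc I j"
  by (simp add: exec_len_def)

lemma first_len_nonneg: "valid_inst I \<Longrightarrow> j \<in> {..<njobs I} \<Longrightarrow> 0 \<le> first_len I j"
  by (simp add: first_len_def valid_inst_def)

lemma exec_len_nonneg: "valid_inst I \<Longrightarrow> j \<in> tested_jobs I \<Longrightarrow> 0 \<le> exec_len I j"
  by (simp add: exec_len_def tested_jobs_def valid_inst_def)

lemma first_end_ge: "j < njobs I \<Longrightarrow> snd (first I j) + first_len I j \<le> first_end I"
  unfolding first_end_def by (intro completion_ge) auto

lemma valid_first: "valid_inst I \<Longrightarrow> valid_placement m {..<njobs I} (first_len I) (first I)"
  unfolding first_def using first_len_nonneg by (intro exact_offline_valid exact) auto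

lemma valid_second: "valid_inst I \<Longrightarrow> valid_placement m (tested_jobs I) (exec_len I) (second I)"
  unfolding second_def using exec_len_nonneg
  by (intro exact_offline_valid exact finite_tested_jobs) auto

lemma second_start_nonneg:
  "valid_inst I \<Longrightarrow> j \<in> tested_jobs I \<Longrightarrow> 0 \<le> snd (second I j)"
  using valid_second by (auto simp: valid_placement_def)

section \<open>Feasibility of the two-phase schedule\<close>

lemma feasible_two_phases:
  assumes I: "valid_inst I"
  shows "feasible m I (two_phases off I)"
proof -
  let ?S = "two_phases off I"
  have m1: "fst (first I j) < m" "0 \<le> snd (first I j)" if "j < njobs I" for j
    using valid_first[OF I] that by (auto simp: valid_placement_def)
  have m2: "fst (second I j) < m" "0 \<le> snd (second I j)" if "j \<in> tested_jobs I" for j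
    using valid_second[OF I] that by (auto simp: valid_placement_def)
  have d1: "snd (first I j) + first_len I j \<le> snd (first I k)
      \<or> snd (first I k) + first_len I k \<le> snd (first I j)"
    if "j < njobs I" "k < njobs I" "j \<noteq> k" "fst (first I j) = fst (first I k)" for j k
    using valid_first[OF I] that by (auto simp: valid_placement_def)
  have d2: "snd (second I j) + proc I j \<le> snd (second I k)
      \<or> snd (second I k) + proc I k \<le> snd (second I j)"
    if "j \<in> tested_jobs I" "k \<in> tested_jobs I" "j \<noteq> k" "fst (second I j) = fst (second I k)"
    for j k
    using valid_second[OF I] that by (auto simp: valid_placement_def exec_len_tested)
  have e: "0 \<le> first_end I"
    by (simp add: first_end_def completion_nonneg)
  \<comment> \<open>The jobs \<open>j\<close> and \<open>k\<close> are independent: arbitrary pairs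
    separate the two phases on a machine, and \<open>j = k\<close> puts each test before its
    execution.\<close>
  have e1: "snd (first I j) + first_len I j \<le> first_end I + snd (second I k)"
    if "j < njobs I" "k \<in> tested_jobs I" for j k
    using first_end_ge[OF that(1)] m2(2)[OF that(2)] by linarith
  have "valid_placement m (pieces I ?S) (piece_len I) (place ?S)"
    unfolding valid_placement_def
  proof (intro conjI ballI impI)
    fix q assume "q \<in> pieces I ?S"
    then show "fst (place ?S q) < m" "0 \<le> snd (place ?S q)"
      using m1 m2 e by (auto simp: pieces_two_phases dest: tested_jobs_less)
  next
    fix q r assume q: "q \<in> pieces I ?S" and r: "r \<in> pieces I ?S"
      and ne: "q \<noteq> r \<and> fst (place ?S q) = fst (place ?S r)"
    \<comment> \<open>Tests and untested runs are treated uniformly as the first-phase piece of a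
      job. The last conjunct shows that the job determines the piece, so distinct pieces belong to
      distinct jobs.\<close>
    have first_piece: "\<exists>j<njobs I. place ?S x = first I j \<and> piece_len I x = first_len I j
        \<and> x = (if j \<in> tested_jobs I then Test j else Run j)"
      if "x \<in> pieces I ?S" "\<nexists>j. x = Exec j" for x
      using that by (auto simp: pieces_two_phases first_len_tested first_len_untested
          tested_jobs_less)
    show "snd (place ?S q) + piece_len I q \<le> snd (place ?S r)
        \<or> snd (place ?S r) + piece_len I r \<le> snd (place ?S q)"
    proof (cases "(\<exists>j. q = Exec j) \<or> (\<exists>j. r = Exec j)")
      case True
      then show ?thesis
      proof (cases "(\<exists>j. q = Exec j) \<and> (\<exists>j. r = Exec j)")
        case True
        then obtain j k where jk: "q = Exec j" "r = Exec k" by blast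
        then have "j \<in> tested_jobs I" "k \<in> tested_jobs I" "j \<noteq> k"
          "fst (second I j) = fst (second I k)"
          using q r ne by (auto simp: pieces_two_phases)
        from d2[OF this] show ?thesis by (auto simp: jk)
      next
        case False
        \<comment> \<open>Exactly one of \<open>q\<close> and \<open>r\<close> is an execution here,
          and it starts after the other piece ends. The goal is symmetric, so this one fact serves
          both orders.\<close>
        have before: "snd (place ?S x) + piece_len I x \<le> snd (place ?S (Exec k))"
          if "x \<in> pieces I ?S" "\<nexists>j. x = Exec j" "Exec k \<in> pieces I ?S" for x k
          using that first_piece[OF that(1,2)] e1[of _ k] by (auto simp: pieces_two_phases)
        from True False q r show ?thesis
          using before by metis
      qed
    next
      case False
      obtain j where j: "j < njobs I" "place ?S q = first I j" "piece_len I q = first_len I j"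
        "q = (if j \<in> tested_jobs I then Test j else Run j)"
        using first_piece[OF q] False by blast
      obtain k where k: "k < njobs I" "place ?S r = first I k" "piece_len I r = first_len I k"
        "r = (if k \<in> tested_jobs I then Test k else Run k)"
        using first_piece[OF r] False by blast
      have "j \<noteq> k" using j(4) k(4) ne by auto
      then show ?thesis using d1[OF j(1) k(1)] ne j(2,3) k(2,3) by simp
    qed
  qed
  moreover have "test_completion I ?S j \<le> start ?S (Exec j)" if "j \<in> tested_jobs I" for j
    using e1[OF tested_jobs_less[OF that] that] that
    by (simp add: test_completion_def first_len_tested)
  ultimately show ?thesis
    by (auto simp: feasible_def tested_jobs_less)
qed

section \<open>Independence from unrevealed processing times\<close>

lemma nonanticipative_two_phases: "nonanticipative (two_phases off)"
  unfolding nonanticipative_def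
proof (intro allI impI, elim conjE)
  fix I I' x
  assume I: "valid_inst I" and I': "valid_inst I'" and same: "same_known_data I I'"
    and known: "\<forall>j\<in>tested (two_phases off I). test_completion I (two_phases off I) j \<le> x
      \<longrightarrow> proc I j = proc I' j"
  have n: "njobs I = njobs I'"
    using same by (simp add: same_known_data_def)
  have T: "tested_jobs I = tested_jobs I'"
    using same by (auto simp: same_known_data_def tested_jobs_def)
  have "first_len I = first_len I'"
    using same by (auto simp: same_known_data_def first_len_def fun_eq_iff)
  then have fi: "first I = first I'" and fe: "first_end I = first_end I'"
    by (simp_all add: first_def first_end_def n)
  have P: "pieces I (two_phases off I) = pieces I' (two_phases off I')"
    by (simp add: pieces_two_phases n T)
  show "started I (two_phases off I) x = started I' (two_phases off I') x"
  \<comment> \<open>From \<open>first_end I\<close> on, every test is complete, so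
    \<open>known\<close> equates all processing times passed to the second call of
    \<open>off\<close>. Before it, no execution has started. At \<open>x = first_end I\<close> an
    execution may already start, but tests ending exactly then count as revealed.\<close>
  proof (cases "first_end I \<le> x")
    case True
    have "proc I j = proc I' j" if j: "j \<in> tested_jobs I" for j
    proof -
      have "test_completion I (two_phases off I) j \<le> first_end I"
        using first_end_ge[OF tested_jobs_less[OF j]] j
        by (simp add: test_completion_def first_len_tested)
      then show ?thesis using known j True by auto
    qed
    then have "exec_len I = exec_len I'"
      using T by (auto simp: exec_len_def fun_eq_iff)
    then have "second I = second I'"
      by (simp add: second_def T)
    then have "place (two_phases off I) q = place (two_phases off I') q" for q
      by (cases q) (simp_all add: fi fe)
    then show ?thesis by (simp add: started_def P)
  next
    case False
    \<comment> \<open>Stated for a generic instance \<open>K\<close> because the second phases of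
      \<open>I\<close> and \<open>I'\<close> may differ, and both must lie beyond
      \<open>x\<close>.\<close>
    have late: "\<not> start (two_phases off K) (Exec j) \<le> x"
      if "valid_inst K" "first_end K = first_end I" "j \<in> tested_jobs K" for K j
      using second_start_nonneg[OF that(1,3)] that(2) False by simp
    have "place (two_phases off I) q = place (two_phases off I') q
        \<or> \<not> start (two_phases off I) q \<le> x \<and> \<not> start (two_phases off I') q \<le> x"
      if "q \<in> pieces I (two_phases off I)" for q
    proof (cases q)
      case (Exec j)
      then have "j \<in> tested_jobs I" using that by (auto simp: pieces_two_phases)
      then show ?thesis using late[OF I refl] late[OF I' fe[symmetric]] T Exec by blast
    qed (simp_all add: fi)
    then show ?thesis unfolding started_def P[symmetric] by force
  qed
qed

section \<open>The factor two against the optimum\<close>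

lemma makespan_two_phases_le:
  assumes "valid_inst I"
  shows "makespan I (two_phases off I) \<le> first_end I + second_end I"
  unfolding makespan_def
proof (rule completion_leI)
  show "finite (pieces I (two_phases off I))"
    by (simp add: pieces_two_phases finite_tested_jobs)
  \<comment> \<open>Needed for tests and untested runs, which are bounded by
    \<open>first_end I\<close> alone.\<close>
  have e2: "0 \<le> second_end I"
    by (simp add: second_end_def completion_nonneg finite_tested_jobs)
  show "0 \<le> first_end I + second_end I"
    using e2 by (simp add: first_end_def completion_nonneg)
  fix q assume q: "q \<in> pieces I (two_phases off I)"
  show "snd (place (two_phases off I) q) + piece_len I q \<le> first_end I + second_end I"
  proof (cases q)
    case (Run j)
    then have j: "j < njobs I" "j \<notin> tested_jobs I"
      using q by (auto simp: pieces_two_phases)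
    then show ?thesis using first_end_ge[OF j(1)] e2 Run by (simp add: first_len_untested)
  next
    case (Test j)
    then have j: "j \<in> tested_jobs I" using q by (auto simp: pieces_two_phases)
    then show ?thesis
      using first_end_ge[OF tested_jobs_less[OF j]] e2 Test by (simp add: first_len_tested)
  next
    case (Exec j)
    then have j: "j \<in> tested_jobs I" using q by (auto simp: pieces_two_phases)
    have "snd (second I j) + exec_len I j \<le> second_end I"
      unfolding second_end_def using j by (intro completion_ge finite_tested_jobs)
    then show ?thesis using j Exec by (simp add: exec_len_tested)
  qed
qed

text \<open>The set \<open>tested S\<close> need not be \<open>tested_jobs I\<close>, so
  \<open>f\<close> follows the choice made by \<open>S\<close>; either choice costs at least the
  minimum of the two lengths.\<close>

lemma first_end_le_makespan:
  assumes I: "valid_inst I" and S: "feasible m I S"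
  shows "first_end I \<le> makespan I S"
  unfolding first_end_def first_def makespan_def
proof (rule exact_offline_completion_le
    [where f = "\<lambda>j. if j \<in> tested S then Test j else Run j", OF exact])
  show "finite (pieces I S)" using S by (simp add: feasible_def finite_pieces)
  show "valid_placement m (pieces I S) (piece_len I) (place S)"
    using S by (simp add: feasible_def)
  show "0 \<le> first_len I j" if "j \<in> {..<njobs I}" for j
    using first_len_nonneg[OF I that] .
qed (auto simp: pieces_def first_len_def inj_on_def split: if_splits)

lemma second_end_le_makespan:
  assumes I: "valid_inst I" and S: "feasible m I S"
  shows "second_end I \<le> makespan I S"
  unfolding second_end_def second_def makespan_def
proof (rule exact_offline_completion_le
    [where f = "\<lambda>j. if j \<in> tested S then Exec j else Run j", OF exact finite_tested_jobs])
  show "finite (pieces I S)" using S by (simp add: feasible_def finite_pieces)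
  show "valid_placement m (pieces I S) (piece_len I) (place S)"
    using S by (simp add: feasible_def)
  show "0 \<le> exec_len I j" if "j \<in> tested_jobs I" for j
    using exec_len_nonneg[OF I that] .
  \<comment> \<open>Equality holds if \<open>S\<close> tests \<open>j\<close>; otherwise this is
    \<open>proc I j \<le> upper I j\<close> from \<open>valid_inst\<close>.\<close>
  show "exec_len I j \<le> piece_len I (if j \<in> tested S then Exec j else Run j)"
    if "j \<in> tested_jobs I" for j
    using that I by (simp add: exec_len_tested tested_jobs_less valid_inst_def)
qed (auto simp: pieces_def inj_on_def tested_jobs_less split: if_splits)

lemma makespan_two_phases_le_opt:
  assumes I: "valid_inst I"
  shows "makespan I (two_phases off I) \<le> 2 * opt m I"
proof -
  \<comment> \<open>With the factor moved to the left, the claim is a lower bound on every feasible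
    makespan and passes to the infimum.\<close>
  have "makespan I (two_phases off I) / 2 \<le> opt m I"
    unfolding opt_def
  proof (rule cInf_greatest)
    \<comment> \<open>The greatest-lower-bound property of \<open>Inf\<close> on the reals requires
      a nonempty set; the schedule of the algorithm itself supplies an element.\<close>
    show "{makespan I S |S. feasible m I S} \<noteq> {}"
      using feasible_two_phases[OF I] by blast
    fix c assume "c \<in> {makespan I S |S. feasible m I S}"
    then obtain S where "c = makespan I S" "feasible m I S" by blast
    then show "makespan I (two_phases off I) / 2 \<le> c"
      using makespan_two_phases_le[OF I] first_end_le_makespan[OF I, of S]
        second_end_le_makespan[OF I, of S] by simp
  qed
  then show ?thesis by simp
qed

end

theorem theorem5:
  fixes m :: nat
    and off :: "nat set \<Rightarrow> (nat \<Rightarrow> real) \<Rightarrow> nat placement"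
  assumes "m \<ge> 1"
    and "exact_offline m off"
  shows "online_algorithm m (two_phases off) \<and> competitive m 2 (two_phases off)"
proof -
  interpret exact_two_phases m off
    by unfold_locales (rule assms(2))
  show ?thesis
    by (simp add: online_algorithm_def competitive_def feasible_two_phases
        nonanticipative_two_phases makespan_two_phases_le_opt)
qed

end
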